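(* Let $(G,+)$ be a countable abelian group, let $(X,\mathcal A,\mu,(T_g)_{g\in G})$ be a strongly mixing system, let $\ell\in\mathbb N$, and let the homomorphisms $\phi_1,\dots,\phi_\ell:G\to G$ be such that for any $j\in\{1,\dots,\ell\}$, $\ker(\phi_j)$ is finite and for any $i\neq j$, $\ker(\phi_j-\phi_i)$ is also finite. Then for any $A_0,\dots,A_\ell\in\mathcal A$ and any $\epsilon>0$ the set $$R^{\phi_1,\dots,\phi_\ell}_\epsilon(A_0,\dots,A_\ell)=\Big\{g\in G : \Big|\mu(A_0\cap T_{\phi_1(g)}A_1\cap\cdots\cap T_{\phi_\ell(g)}A_\ell)-\prod_{j=0}^\ell\mu(A_j)\Big|<\epsilon\Big\}$$ is $\Sigma_\ell^*$.
   Context: $\mathbb N=\{1,2,\dots\}$. A measure preserving system $(X,\mathcal A,\mu,(T_g)_{g\in G})$ consists of a separable probability space and an action of the countable discrete abelian group $G$ on it by (invertible) $\mu$-preserving transformations; as a standing assumption the space is regular, i.e. $X$ is a compact metric space and $\mathcal A=\mathrm{Borel}(X)$. For a sequence in $G$, $\lim_{k\to\infty}g_k=\infty$ means that for every finite $F\subseteq G$, $g_k\notin F$ for all large $k$. The system is strongly mixing if $\lim_{g\to\infty}\mu(A_0\cap T_gA_1)=\mu(A_0)\mu(A_1)$ for all $A_0,A_1\in\mathcal A$. A set $E\subseteq G$ is a $\Sigma_m$ set if $E=\{g^{(1)}_{k_1}+\cdots+g^{(m)}_{k_m} : k_1<\cdots<k_m\}$ (with $k_1,\dots,k_m\in\mathbb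 N$), where for each $j\in\{1,\dots,m\}$, $(g^{(j)}_k)_{k\in\mathbb N}$ is a sequence in $G$ with $\lim_{k\to\infty}g^{(j)}_k=\infty$. A subset of $G$ is $\Sigma_m^*$ if it has non-empty intersection with every $\Sigma_m$ set. *)

theory Defs
  imports "HOL-Probability.Probability"
begin

text \<open>
  Measure preserving actions of a countable discrete abelian group (the additive group of the
  type \<open>'g\<close>) on a regular probability space: the underlying space is a compact metric space,
  given as a compact subset of a metric space type, with its Borel sets. Separability of the
  probability space follows. Each \<open>T g\<close> is automatically invertible on \<open>space M\<close>, with
  inverse \<open>T (- g)\<close>; its values outside \<open>space M\<close> are irrelevant.
\<close>

locale measure_preserving_system = prob_space M
  for M :: "'x::metric_space measure" +
  fixes T :: "'g::{countable, ab_group_add} \<Rightarrow> 'x \<Rightarrow> 'x"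
  assumes compact_space: "compact (space M)"
    and sets_borel: "sets M = sets (restrict_space borel (space M))"
    and measurable_T: "T g \<in> measurable M M"
    and T_zero: "x \<in> space M \<Longrightarrow> T 0 x = x"
    and T_add: "x \<in> space M \<Longrightarrow> T (g + h) x = T g (T h x)"
    and measure_preserving:
      "B \<in> sets M \<Longrightarrow> measure M (T g -` B \<inter> space M) = measure M B"

locale strongly_mixing_system = measure_preserving_system M T
  for M :: "'x::metric_space measure" and T :: "'g::{countable, ab_group_add} \<Rightarrow> 'x \<Rightarrow> 'x" +
  assumes strongly_mixing:
    "A0 \<in> sets M \<Longrightarrow> A1 \<in> sets M \<Longrightarrow>
      ((\<lambda>g. measure M (A0 \<inter> T g ` A1)) \<longlongrightarrow> measure M A0 * measure M A1) cofinite"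

text \<open>
  Divergence to infinity in the discrete group is convergence along the cofinite filter.
\<close>

lemma filterlim_cofinite_sequentially_iff:
  fixes g :: "nat \<Rightarrow> 'g"
  shows "filterlim g cofinite sequentially \<longleftrightarrow>
    (\<forall>F. finite F \<longrightarrow> (\<forall>\<^sub>F k in sequentially. g k \<notin> F))"
proof
  assume L: "filterlim g cofinite sequentially"
  show "\<forall>F. finite F \<longrightarrow> (\<forall>\<^sub>F k in sequentially. g k \<notin> F)"
  proof (intro allI impI)
    fix F :: "'g set" assume "finite F"
    then have "\<forall>\<^sub>F x in cofinite. x \<notin> F"
      by (simp add: eventually_cofinite)
    then show "\<forall>\<^sub>F k in sequentially. g k \<notin> F"
      using L by (rule eventually_compose_filterlim)
  qed
next
  assume R: "\<forall>F. finite F \<longrightarrow> (\<forall>\<^sub>F k in sequentially. g k \<notin> F)"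
  show "filterlim g cofinite sequentially"
    unfolding filterlim_iff eventually_cofinite
  proof (intro allI impI)
    fix P :: "'g \<Rightarrow> bool" assume "finite {x. \<not> P x}"
    with R have "\<forall>\<^sub>F k in sequentially. g k \<notin> {x. \<not> P x}" by blast
    then show "\<forall>\<^sub>F k in sequentially. P (g k)" by simp
  qed
qed

text \<open>
  Indices range over the positive integers, so \<open>g j 0\<close> is ignored.
\<close>

definition Sigma_set :: "nat \<Rightarrow> 'g::ab_group_add set \<Rightarrow> bool" where
  "Sigma_set m E \<longleftrightarrow>
    (\<exists>g :: nat \<Rightarrow> nat \<Rightarrow> 'g.
      (\<forall>j\<in>{1..m}. filterlim (g j) cofinite sequentially) \<and>
      E = {\<Sum>j=1..m. g j (k j) | k :: nat \<Rightarrow> nat.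
             (\<forall>j\<in>{1..m}. 1 \<le> k j) \<and> strict_mono_on {1..m} k})"

definition Sigma_star :: "nat \<Rightarrow> 'g::ab_group_add set \<Rightarrow> bool" where
  "Sigma_star m S \<longleftrightarrow> (\<forall>E. Sigma_set m E \<longrightarrow> S \<inter> E \<noteq> {})"

definition return_set ::
    "'x measure \<Rightarrow> ('g \<Rightarrow> 'x \<Rightarrow> 'x) \<Rightarrow> nat \<Rightarrow> (nat \<Rightarrow> 'g \<Rightarrow> 'g) \<Rightarrow> (nat \<Rightarrow> 'x set) \<Rightarrow> real \<Rightarrow> 'g set"
  where
  "return_set M T l \<phi> A \<epsilon> =
    {g. \<bar>measure M (A 0 \<inter> (\<Inter>j\<in>{1..l}. T (\<phi> j g) ` A j)) - (\<Prod>j=0..l. measure M (A j))\<bar> < \<epsilon>}"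

end

theory Submission
  imports Defs
begin

text \<open>
  The theorem follows from a symmetric statement, proved by induction on \<open>m\<close>: if \<open>m + 1\<close>
  homomorphisms \<open>\<phi> j\<close>, \<open>j \<in> J\<close>, have pairwise differences with finite kernels, then every
  \<open>\<Sigma>\<^sub>m\<close> set contains some \<open>g\<close> for which the events \<open>T (\<phi> j g) ` A j\<close> are nearly independent,
  simultaneously for finitely many tuples \<open>A\<close>. The theorem is the case \<open>J = {0..l}\<close>, \<open>\<phi> 0 = 0\<close>.

  For the inductive step, fix a pivot \<open>p \<in> J\<close> and put \<open>\<psi> j = \<phi> j - \<phi> p\<close>. By invariance of the
  measure, the intersection of all the translates at \<open>g\<close> has the probability of \<open>A p \<inter> B\<close>, where
  \<open>B\<close> is the intersection of the \<open>T (\<psi> j g) ` A j\<close> over \<open>j \<noteq> p\<close>. A \<open>\<Sigma>\<close>-set of order \<open>m + 1\<close> contains,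
  for finitely many terms \<open>g i\<close> of its first sequence, all sums \<open>g i + h\<close> with \<open>h\<close> in a common
  \<open>\<Sigma>\<^sub>m\<close> set (\<open>Sigma_set_Suc_split\<close>). Write \<open>B i\<close> for the event \<open>B\<close> at \<open>g i + h\<close>. Then
  \<open>B i \<inter> B k\<close> is the intersection of the \<open>T (\<psi> j h) ` C j\<close>, where
  \<open>C j = T (\<psi> j (g i)) ` A j \<inter> T (\<psi> j (g k)) ` A j\<close>. The induction hypothesis provides an \<open>h\<close> for
  which \<open>B i \<inter> B k\<close> has probability close to the product of the probabilities of the \<open>C j\<close>, for all
  the finitely many pairs at once; and if the \<open>g i\<close> are far enough apart, strong mixing makes that
  product close to \<open>c\<^sup>2\<close>, where \<open>c\<close> is the product of the probabilities of the \<open>A j\<close>, \<open>j \<noteq> p\<close>.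
  Thus the events \<open>B i\<close> have probability nearly \<open>c\<close> and are nearly pairwise independent.

  Such events give nearly orthogonal vectors \<open>1\<^bsub>B i\<^esub> - c\<close> in \<open>L\<^sup>2\<close>, so, as in Bessel's inequality,
  only boundedly many of them correlate noticeably with \<open>A p\<close> (\<open>few_correlated_events\<close>). The bound
  depends on \<open>\<epsilon>\<close> alone, so once there are sufficiently many indices \<open>i\<close>, one of them works
  for all tuples.
\<close>

section \<open>Quasi-independent events\<close>

lemma (in prob_space) square_expectation_le:
  fixes X :: "'a \<Rightarrow> real"
  assumes "integrable M X" "integrable M (\<lambda>x. (X x)\<^sup>2)"
  shows "(expectation X)\<^sup>2 \<le> expectation (\<lambda>x. (X x)\<^sup>2)"
  using variance_positive[of X] variance_eq[OF assms] by simp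

text \<open>
  The Cauchy--Schwarz inequality for \<open>1\<^bsub>A\<^esub>\<close> and \<open>\<Sum>i\<in>J. s i * (1\<^bsub>B i\<^esub> - c)\<close>, with all inner products
  of the vectors \<open>1\<^bsub>B i\<^esub> - c\<close> written out.
\<close>

lemma (in prob_space) weighted_correlation_sum_le:
  fixes s :: "'i \<Rightarrow> real"
  assumes J: "finite J" and A: "A \<in> events" and B: "\<And>i. i \<in> J \<Longrightarrow> B i \<in> events"
  shows "(\<Sum>i\<in>J. s i * (prob (A \<inter> B i) - c * prob A))\<^sup>2
    \<le> (\<Sum>i\<in>J. \<Sum>k\<in>J. s i * s k * (prob (B i \<inter> B k) - c * prob (B i) - c * prob (B k) + c\<^sup>2))"
proof -
  define Y where "Y i x = indicat_real (B i) x - c" for i x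
  define S where "S x = (\<Sum>i\<in>J. s i * Y i x)" for x
  have YY: "Y i x * Y k x = indicat_real (B i \<inter> B k) x - c * indicat_real (B i) x
      - c * indicat_real (B k) x + c\<^sup>2" for i k x
    by (simp add: Y_def indicator_inter_arith algebra_simps power2_eq_square)
  have AY: "indicat_real A x * Y i x = indicat_real (A \<inter> B i) x - c * indicat_real A x" for i x
    by (simp add: Y_def indicator_inter_arith algebra_simps)
  have S2: "(S x)\<^sup>2 = (\<Sum>i\<in>J. \<Sum>k\<in>J. s i * s k * (Y i x * Y k x))" for x
    by (simp add: S_def power2_eq_square sum_product mult_ac)
  have AS: "indicat_real A x * S x = (\<Sum>i\<in>J. s i * (indicat_real A x * Y i x))" for x
    by (simp add: S_def sum_distrib_left mult_ac)
  have AS2: "(indicat_real A x * S x)\<^sup>2 \<le> (S x)\<^sup>2" for x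
    by (simp add: indicator_def)
  have ind: "has_bochner_integral M (indicat_real C) (prob C)" if "C \<in> events" for C
    using that by (intro has_bochner_integral_real_indicator) (auto simp: less_top[symmetric])
  have const: "has_bochner_integral M (\<lambda>_. b) b" for b :: real
    by (simp add: has_bochner_integral_iff prob_space)
  have hYY: "has_bochner_integral M (\<lambda>x. Y i x * Y k x)
      (prob (B i \<inter> B k) - c * prob (B i) - c * prob (B k) + c\<^sup>2)" if "i \<in> J" "k \<in> J" for i k
    unfolding YY using B[OF that(1)] B[OF that(2)]
    by (intro has_bochner_integral_add has_bochner_integral_diff has_bochner_integral_mult_right
        ind const sets.Int)
  have hAY: "has_bochner_integral M (\<lambda>x. indicat_real A x * Y i x) (prob (A \<inter> B i) - c * prob A)"
    if "i \<in> J" for i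
    unfolding AY using B[OF that] A
    by (intro has_bochner_integral_diff has_bochner_integral_mult_right ind sets.Int)
  note iYY = hYY[THEN integrable.intros] and eYY = hYY[THEN has_bochner_integral_integral_eq]
  note iAY = hAY[THEN integrable.intros] and eAY = hAY[THEN has_bochner_integral_integral_eq]
  have iS2: "integrable M (\<lambda>x. (S x)\<^sup>2)"
    unfolding S2 using iYY by (intro Bochner_Integration.integrable_sum) auto
  have iAS: "integrable M (\<lambda>x. indicat_real A x * S x)"
    unfolding AS using iAY by (intro Bochner_Integration.integrable_sum) auto
  have iAS2: "integrable M (\<lambda>x. (indicat_real A x * S x)\<^sup>2)"
    by (rule Bochner_Integration.integrable_bound[OF iS2])
      (use AS2 borel_measurable_integrable[OF iAS] in auto)
  have "(\<Sum>i\<in>J. s i * (prob (A \<inter> B i) - c * prob A)) = expectation (\<lambda>x. indicat_real A x * S x)"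
    unfolding AS using iAY by (subst Bochner_Integration.integral_sum) (auto simp: eAY)
  then have "(\<Sum>i\<in>J. s i * (prob (A \<inter> B i) - c * prob A))\<^sup>2
      \<le> expectation (\<lambda>x. (indicat_real A x * S x)\<^sup>2)"
    using square_expectation_le[OF iAS iAS2] by simp
  also have "\<dots> \<le> expectation (\<lambda>x. (S x)\<^sup>2)"
    by (rule integral_mono[OF iAS2 iS2 AS2])
  also have "\<dots> = (\<Sum>i\<in>J. \<Sum>k\<in>J. s i * s k *
      (prob (B i \<inter> B k) - c * prob (B i) - c * prob (B k) + c\<^sup>2))"
    unfolding S2 using iYY
    by (subst Bochner_Integration.integral_sum; simp add: eYY Bochner_Integration.integral_sum)
  finally show ?thesis .
qed

text \<open>
  If \<open>N\<close> of the vectors \<open>1\<^bsub>B i\<^esub> - c\<close> have inner product of absolute value at least \<open>\<epsilon>\<close> with \<open>1\<^bsub>A\<^esub>\<close>,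
  their signed sum has inner product at least \<open>N * \<epsilon>\<close> with \<open>1\<^bsub>A\<^esub>\<close>, while its squared norm is at most
  \<open>N\<close> from the diagonal plus \<open>3 * \<delta> * N\<^sup>2\<close> from the nearly orthogonal pairs.
\<close>

lemma (in prob_space) few_correlated_events:
  fixes c \<delta> \<epsilon> :: real
  assumes I: "finite I" and A: "A \<in> events" and B: "\<And>i. i \<in> I \<Longrightarrow> B i \<in> events"
    and c: "0 \<le> c" "c \<le> 1" and "0 \<le> \<delta>" and \<epsilon>: "0 < \<epsilon>"
    and single: "\<And>i. i \<in> I \<Longrightarrow> \<bar>prob (B i) - c\<bar> \<le> \<delta>"
    and pair: "\<And>i k. i \<in> I \<Longrightarrow> k \<in> I \<Longrightarrow> i \<noteq> k \<Longrightarrow> \<bar>prob (B i \<inter> B k) - c\<^sup>2\<bar> \<le> \<delta>"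
  shows "real (card {i \<in> I. \<epsilon> \<le> \<bar>prob (A \<inter> B i) - c * prob A\<bar>}) * (\<epsilon>\<^sup>2 - 3 * \<delta>) \<le> 1"
proof -
  define J where "J = {i \<in> I. \<epsilon> \<le> \<bar>prob (A \<inter> B i) - c * prob A\<bar>}"
  define a where "a i = prob (A \<inter> B i) - c * prob A" for i
  define d where "d i k = prob (B i \<inter> B k) - c * prob (B i) - c * prob (B k) + c\<^sup>2" for i k
  let ?N = "real (card J)"
  have J: "finite J" "J \<subseteq> I" using I by (auto simp: J_def)
  have offdiag: "\<bar>d i k\<bar> \<le> 3 * \<delta>" if "i \<in> J" "k \<in> J" "i \<noteq> k" for i k
  proof -
    have ik: "i \<in> I" "k \<in> I" using that J by auto
    have scaled: "\<bar>c * (prob (B j) - c)\<bar> \<le> \<delta>" if "j \<in> I" for j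
      using mult_mono[OF c(2) single[OF that]] c by (simp add: abs_mult)
    have "d i k = (prob (B i \<inter> B k) - c\<^sup>2) - c * (prob (B i) - c) - c * (prob (B k) - c)"
      by (simp add: d_def algebra_simps power2_eq_square)
    then show ?thesis
      using pair[OF ik that(3)] scaled[OF ik(1)] scaled[OF ik(2)] by linarith
  qed
  have diag: "\<bar>d i i\<bar> \<le> 1" for i
  proof -
    let ?p = "prob (B i)"
    have eq: "d i i = ?p * (1 - c)\<^sup>2 + (1 - ?p) * c\<^sup>2"
      by (simp add: d_def algebra_simps power2_eq_square)
    have "(1 - c)\<^sup>2 \<le> 1" "c\<^sup>2 \<le> 1"
      using c by (simp_all add: power_le_one)
    then have "?p * (1 - c)\<^sup>2 \<le> ?p" "(1 - ?p) * c\<^sup>2 \<le> 1 - ?p"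
      by (auto intro!: mult_left_le)
    moreover have "0 \<le> d i i" unfolding eq by (auto intro!: add_nonneg_nonneg mult_nonneg_nonneg)
    ultimately show ?thesis using eq by linarith
  qed
  have "?N * \<epsilon> = (\<Sum>i\<in>J. \<epsilon>)" by simp
  also have "\<dots> \<le> (\<Sum>i\<in>J. sgn (a i) * a i)"
    by (rule sum_mono) (simp add: J_def a_def abs_sgn mult.commute)
  finally have "(?N * \<epsilon>)\<^sup>2 \<le> (\<Sum>i\<in>J. sgn (a i) * a i)\<^sup>2"
    using \<epsilon> by (intro power_mono) auto
  also have "\<dots> \<le> (\<Sum>i\<in>J. \<Sum>k\<in>J. sgn (a i) * sgn (a k) * d i k)"
    unfolding a_def d_def using J A B by (intro weighted_correlation_sum_le) auto
  also have "\<dots> \<le> (\<Sum>i\<in>J. \<Sum>k\<in>J. (if k = i then 1 else 0) + 3 * \<delta>)"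
  proof (intro sum_mono)
    fix i k assume ik: "i \<in> J" "k \<in> J"
    have "sgn (a i) * sgn (a k) * d i k \<le> \<bar>sgn (a i) * sgn (a k) * d i k\<bar>" by simp
    also have "\<dots> \<le> 1 * \<bar>d i k\<bar>"
      unfolding abs_mult by (intro mult_right_mono) (auto simp: sgn_if)
    also have "\<dots> \<le> (if k = i then 1 else 0) + 3 * \<delta>"
      using diag[of i] offdiag[OF ik] \<open>0 \<le> \<delta>\<close> by auto
    finally show "sgn (a i) * sgn (a k) * d i k \<le> (if k = i then 1 else 0) + 3 * \<delta>" .
  qed
  also have "\<dots> = ?N + ?N * ?N * (3 * \<delta>)"
    using J by (simp add: sum.distrib sum.delta algebra_simps)
  finally have "?N * (?N * (\<epsilon>\<^sup>2 - 3 * \<delta>)) \<le> ?N * 1"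
    by (simp add: algebra_simps power2_eq_square)
  then have "?N * (\<epsilon>\<^sup>2 - 3 * \<delta>) \<le> 1"
    by (cases "card J = 0") (auto simp: mult_le_cancel_left)
  then show ?thesis unfolding J_def .
qed


section \<open>Divergence to infinity and \<Sigma>-sets\<close>

lemma exists_pairwise_eventual_set:
  assumes "\<And>i. \<forall>\<^sub>F k in sequentially. R i k"
  shows "\<exists>I. finite I \<and> card I = n \<and> (\<forall>i\<in>I. 1 \<le> i) \<and> (\<forall>i\<in>I. \<forall>k\<in>I. i < k \<longrightarrow> R i (k::nat))"
proof (induction n)
  case 0
  show ?case by (rule exI[of _ "{}"]) simp
next
  case (Suc n)
  then obtain I where I: "finite I" "card I = n" "\<forall>i\<in>I. 1 \<le> i"
    "\<forall>i\<in>I. \<forall>k\<in>I. i < k \<longrightarrow> R i k" by blast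
  have "\<forall>\<^sub>F k in sequentially. (\<forall>i\<in>I. R i k \<and> i < k) \<and> 1 \<le> k"
    using I assms
    by (intro eventually_conj eventually_ball_finite ballI eventually_gt_at_top eventually_ge_at_top)
  then obtain k where k: "\<forall>i\<in>I. R i k \<and> i < k" "1 \<le> k"
    using eventually_happens'[OF sequentially_bot] by blast
  have "k \<notin> I" using k by blast
  then show ?case
    using I k by (intro exI[of _ "insert k I"]) (auto dest: less_asym)
qed

text \<open>Every fibre is empty or a translate of the kernel.\<close>

lemma filterlim_additive_cofinite:
  fixes \<psi> :: "'g::ab_group_add \<Rightarrow> 'h::ab_group_add"
  assumes "Modules.additive \<psi>" "finite {g. \<psi> g = 0}"
  shows "filterlim \<psi> cofinite cofinite"
proof -
  interpret Modules.additive \<psi> by fact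
  have fib: "finite (\<psi> -` {y})" for y
  proof (cases "\<exists>x. \<psi> x = y")
    case True
    then obtain x where "\<psi> x = y" by blast
    have "\<psi> -` {y} \<subseteq> (\<lambda>g. g + x) ` {g. \<psi> g = 0}"
    proof
      fix z assume "z \<in> \<psi> -` {y}"
      then have "z = (z - x) + x" "\<psi> (z - x) = 0" using \<open>\<psi> x = y\<close> by (simp_all add: diff)
      then show "z \<in> (\<lambda>g. g + x) ` {g. \<psi> g = 0}" by blast
    qed
    then show ?thesis using assms(2) finite_surj by blast
  next
    case False
    then have "\<psi> -` {y} = {}" by auto
    then show ?thesis by simp
  qed
  show ?thesis
    unfolding filterlim_iff eventually_cofinite
  proof (intro allI impI)
    fix P :: "'h \<Rightarrow> bool" assume fin: "finite {y. \<not> P y}"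
    have "{x. \<not> P (\<psi> x)} = (\<Union>y\<in>{y. \<not> P y}. \<psi> -` {y})" by auto
    then show "finite {x. \<not> P (\<psi> x)}" using fin fib by simp
  qed
qed

lemma filterlim_diff_const_cofinite:
  fixes g :: "'i \<Rightarrow> 'g::ab_group_add"
  assumes "filterlim g cofinite F"
  shows "filterlim (\<lambda>k. g k - a) cofinite F"
proof -
  have "filterlim (\<lambda>x::'g. x - a) cofinite cofinite"
    unfolding filterlim_iff eventually_cofinite
  proof (intro allI impI)
    fix P :: "'g \<Rightarrow> bool" assume fin: "finite {y. \<not> P y}"
    have "{x. \<not> P (x - a)} \<subseteq> (\<lambda>y. y + a) ` {y. \<not> P y}"
      by (auto simp: image_iff intro!: exI[of _ "_ - a"])
    then show "finite {x. \<not> P (x - a)}" using fin finite_surj by blast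
  qed
  then show ?thesis using assms by (rule filterlim_compose)
qed

lemma Sigma_set_nonempty:
  assumes "Sigma_set m E"
  shows "E \<noteq> {}"
proof -
  have "(\<forall>j\<in>{1..m}. 1 \<le> id j) \<and> strict_mono_on {1..m} (id :: nat \<Rightarrow> nat)"
    by (auto simp: strict_mono_on_def)
  then show ?thesis using assms unfolding Sigma_set_def by blast
qed

text \<open>
  The first index of a \<open>\<Sigma>\<close>-set may be chosen freely up to a bound \<open>K\<close> before the others:
  dropping the first \<open>K\<close> terms of the remaining sequences forces their indices to be larger. That
  \<open>E'\<close> does not depend on \<open>i\<close> is what allows several values of \<open>i\<close> to be compared at the same \<open>h\<close>.
\<close>

lemma Sigma_set_Suc_split:
  fixes E :: "'g::ab_group_add set"
  assumes "Sigma_set (Suc m) E"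
  obtains g where "filterlim g cofinite sequentially"
    and "\<And>K. \<exists>E'. Sigma_set m E' \<and> (\<forall>i\<in>{1..K}. \<forall>h\<in>E'. g i + h \<in> E)"
proof -
  obtain g :: "nat \<Rightarrow> nat \<Rightarrow> 'g" where g: "\<forall>j\<in>{1..Suc m}. filterlim (g j) cofinite sequentially"
    and E: "E = {\<Sum>j=1..Suc m. g j (k j) | k :: nat \<Rightarrow> nat.
      (\<forall>j\<in>{1..Suc m}. 1 \<le> k j) \<and> strict_mono_on {1..Suc m} k}"
    using assms unfolding Sigma_set_def by blast
  have "\<exists>E'. Sigma_set m E' \<and> (\<forall>i\<in>{1..K}. \<forall>h\<in>E'. g 1 i + h \<in> E)" for K
  proof -
    define g' where "g' j k = g (Suc j) (k + K)" for j k
    define E' where "E' = {\<Sum>j=1..m. g' j (k j) | k :: nat \<Rightarrow> nat.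
      (\<forall>j\<in>{1..m}. 1 \<le> k j) \<and> strict_mono_on {1..m} k}"
    have "filterlim (g' j) cofinite sequentially" if "j \<in> {1..m}" for j
      unfolding g'_def using g that
      by (intro filterlim_compose[OF _ filterlim_add_const_nat_at_top]) auto
    then have "Sigma_set m E'" unfolding Sigma_set_def E'_def by blast
    moreover have "g 1 i + h \<in> E" if i: "i \<in> {1..K}" and h: "h \<in> E'" for i h
    proof -
      obtain k where hk: "h = (\<Sum>j=1..m. g' j (k j))" and k: "\<forall>j\<in>{1..m}. 1 \<le> k j"
        and mono: "strict_mono_on {1..m} k" using h unfolding E'_def by blast
      define k' where "k' j = (if j = 1 then i else k (j - 1) + K)" for j
      have ge: "\<forall>j\<in>{1..Suc m}. 1 \<le> k' j"
      proof
        fix j assume "j \<in> {1..Suc m}"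
        then show "1 \<le> k' j"
          using i k[rule_format, of "j - 1"] by (auto simp: k'_def)
      qed
      have sm: "strict_mono_on {1..Suc m} k'"
      proof (rule strict_mono_onI)
        fix r s assume rs: "r \<in> {1..Suc m}" "s \<in> {1..Suc m}" "r < s"
        have s: "s - 1 \<in> {1..m}" using rs by auto
        show "k' r < k' s"
        proof (cases "r = 1")
          case True
          then show ?thesis using rs s i k by (fastforce simp: k'_def)
        next
          case False
          then have "k (r - 1) < k (s - 1)"
            using rs s by (intro strict_mono_onD[OF mono]) auto
          then show ?thesis using rs False by (auto simp: k'_def)
        qed
      qed
      have "(\<Sum>j=1..Suc m. g j (k' j)) = g 1 (k' 1) + (\<Sum>j=Suc 1..Suc m. g j (k' j))"
        by (rule sum.atLeast_Suc_atMost) simp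
      also have "(\<Sum>j=Suc 1..Suc m. g j (k' j)) = (\<Sum>j=1..m. g (Suc j) (k' (Suc j)))"
        by (rule sum.shift_bounds_cl_Suc_ivl)
      also have "\<dots> = h"
        unfolding hk g'_def by (rule sum.cong) (auto simp: k'_def)
      finally have "g 1 i + h = (\<Sum>j=1..Suc m. g j (k' j))" by (simp add: k'_def)
      then show ?thesis unfolding E using ge sm by blast
    qed
    ultimately show ?thesis by blast
  qed
  moreover have "filterlim (g 1) cofinite sequentially" using g by auto
  ultimately show thesis using that by blast
qed


section \<open>Translates of events\<close>

context measure_preserving_system
begin

lemma T_minus_T: "x \<in> space M \<Longrightarrow> T (- g) (T g x) = x"
  using T_add[of x "- g" g] T_zero by simp

lemma T_image_eq_vimage:
  assumes "A \<subseteq> space M"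
  shows "T g ` A = T (- g) -` A \<inter> space M"
proof (intro equalityI subsetI)
  fix y assume "y \<in> T g ` A"
  then show "y \<in> T (- g) -` A \<inter> space M"
    using assms T_minus_T measurable_space[OF measurable_T] by fastforce
next
  fix y assume y: "y \<in> T (- g) -` A \<inter> space M"
  then have "y = T g (T (- g) y)" using T_minus_T[of y "- g"] by simp
  then show "y \<in> T g ` A" using y by blast
qed

lemma T_image_sets [intro, simp]: "A \<in> sets M \<Longrightarrow> T g ` A \<in> sets M"
  using T_image_eq_vimage[OF sets.sets_into_space] measurable_sets[OF measurable_T] by metis

lemma prob_T_image [simp]: "A \<in> sets M \<Longrightarrow> prob (T g ` A) = prob A"
  using T_image_eq_vimage[OF sets.sets_into_space] measure_preserving by metis

lemma inj_on_T: "inj_on (T g) (space M)"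
  using T_minus_T by (rule inj_on_inverseI)

lemma T_image_add: "A \<in> sets M \<Longrightarrow> T (g + h) ` A = T g ` T h ` A"
  unfolding image_image by (intro image_cong refl T_add) (auto dest: sets.sets_into_space)

lemma T_image_Int: "A \<in> sets M \<Longrightarrow> B \<in> sets M \<Longrightarrow> T g ` (A \<inter> B) = T g ` A \<inter> T g ` B"
  by (rule inj_on_image_Int[OF inj_on_T]) (auto dest: sets.sets_into_space)

lemma T_image_INT:
  assumes "J \<noteq> {}" "\<And>j. j \<in> J \<Longrightarrow> A j \<in> sets M"
  shows "T g ` (\<Inter>j\<in>J. A j) = (\<Inter>j\<in>J. T g ` A j)"
proof -
  obtain j where "j \<in> J" using assms(1) by blast
  then show ?thesis
    using assms(2) by (intro image_INT[OF inj_on_T]) (auto dest: sets.sets_into_space)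
qed

lemma prob_T_image_Int:
  assumes "A \<in> sets M" "B \<in> sets M"
  shows "prob (T g ` A \<inter> T h ` B) = prob (A \<inter> T (h - g) ` B)"
proof -
  have "T g ` A \<inter> T h ` B = T g ` (A \<inter> T (h - g) ` B)"
    using assms T_image_add[of B g "h - g"] by (simp add: T_image_Int)
  then show ?thesis using assms by (simp add: sets.Int)
qed

text \<open>
  Translating by \<open>- \<phi> p\<close> frees the event of index \<open>p\<close> from the group element, so that the same event
  can be tested against many others.
\<close>

lemma prob_INT_T_image_pivot:
  assumes "finite J" "p \<in> J" "\<And>j. j \<in> J \<Longrightarrow> A j \<in> sets M"
  shows "prob (\<Inter>j\<in>J. T (\<phi> j) ` A j) = prob (A p \<inter> (\<Inter>j\<in>J - {p}. T (\<phi> j - \<phi> p) ` A j))"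
proof (cases "J = {p}")
  case True
  then show ?thesis using assms(3) by simp
next
  case False
  let ?D = "\<Inter>j\<in>J - {p}. T (\<phi> j - \<phi> p) ` A j"
  have ne: "J - {p} \<noteq> {}" using assms False by blast
  have D: "?D \<in> sets M" using assms ne by (intro sets.finite_INT) auto
  have "(\<Inter>j\<in>J. T (\<phi> j) ` A j) = T (\<phi> p) ` A p \<inter> (\<Inter>j\<in>J - {p}. T (\<phi> j) ` A j)"
    using assms(2) by auto
  also have "(\<Inter>j\<in>J - {p}. T (\<phi> j) ` A j) = (\<Inter>j\<in>J - {p}. T (\<phi> p) ` T (\<phi> j - \<phi> p) ` A j)"
    using assms(3) T_image_add[of _ "\<phi> p" "\<phi> j - \<phi> p" for j, symmetric] by simp
  also have "\<dots> = T (\<phi> p) ` ?D"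
    using assms ne by (subst T_image_INT) auto
  also have "T (\<phi> p) ` A p \<inter> T (\<phi> p) ` ?D = T (\<phi> p) ` (A p \<inter> ?D)"
    using assms D by (simp add: T_image_Int)
  finally show ?thesis using assms D by simp
qed

end


section \<open>Approximate independence along \<Sigma>-sets\<close>

context strongly_mixing_system
begin

text \<open>
  Up to translation, the \<open>j\<close>-th factor is the correlation of \<open>A j\<close> with its translate by
  \<open>\<psi> j (g k - a)\<close>, which tends to infinity because \<open>\<psi> j\<close> has finite kernel; so each factor
  converges by strong mixing.
\<close>

lemma product_self_correlation_tendsto:
  assumes J: "finite J" and \<psi>: "\<And>j. j \<in> J \<Longrightarrow> Modules.additive (\<psi> j)"
    "\<And>j. j \<in> J \<Longrightarrow> finite {g. \<psi> j g = 0}"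
    and A: "\<And>j. j \<in> J \<Longrightarrow> A j \<in> sets M" and g: "filterlim g cofinite F"
  shows "((\<lambda>k. \<Prod>j\<in>J. prob (T (\<psi> j a) ` A j \<inter> T (\<psi> j (g k)) ` A j))
    \<longlongrightarrow> (\<Prod>j\<in>J. prob (A j))\<^sup>2) F"
proof -
  have "((\<lambda>k. prob (T (\<psi> j a) ` A j \<inter> T (\<psi> j (g k)) ` A j)) \<longlongrightarrow> prob (A j) * prob (A j)) F"
    if j: "j \<in> J" for j
  proof -
    have "filterlim (\<lambda>k. \<psi> j (g k - a)) cofinite F"
      by (rule filterlim_compose[OF filterlim_additive_cofinite[OF \<psi>[OF j]]])
        (rule filterlim_diff_const_cofinite[OF g])
    then have "((\<lambda>k. prob (A j \<inter> T (\<psi> j (g k - a)) ` A j)) \<longlongrightarrow> prob (A j) * prob (A j)) F"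
      by (rule filterlim_compose[OF strongly_mixing[OF A[OF j] A[OF j]]])
    then show ?thesis
      using A[OF j] by (simp add: prob_T_image_Int Modules.additive.diff[OF \<psi>(1)[OF j]])
  qed
  then have "((\<lambda>k. \<Prod>j\<in>J. prob (T (\<psi> j a) ` A j \<inter> T (\<psi> j (g k)) ` A j))
      \<longlongrightarrow> (\<Prod>j\<in>J. prob (A j) * prob (A j))) F"
    by (rule tendsto_prod)
  then show ?thesis by (simp add: prod.distrib power2_eq_square)
qed

text \<open>
  The finite family \<open>\<A>\<close> is essential to the induction: a single tuple for \<open>m + 1\<close> leads to one tuple
  for \<open>m\<close> for each pair of indices \<open>i, k\<close>, and these have to be handled by a common \<open>h\<close>.
\<close>

lemma Sigma_set_approx_independent:
  fixes \<phi> :: "'i \<Rightarrow> 'g \<Rightarrow> 'g" and \<A> :: "('i \<Rightarrow> 'x set) set"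
  assumes "finite J" "card J = Suc m"
    and "\<And>j. j \<in> J \<Longrightarrow> Modules.additive (\<phi> j)"
    and "\<And>i j. i \<in> J \<Longrightarrow> j \<in> J \<Longrightarrow> i \<noteq> j \<Longrightarrow> finite {g. \<phi> j g - \<phi> i g = 0}"
    and "finite \<A>" and "\<And>A j. A \<in> \<A> \<Longrightarrow> j \<in> J \<Longrightarrow> A j \<in> sets M"
    and "0 < \<epsilon>" and "Sigma_set m E"
  shows "\<exists>g\<in>E. \<forall>A\<in>\<A>. \<bar>prob (\<Inter>j\<in>J. T (\<phi> j g) ` A j) - (\<Prod>j\<in>J. prob (A j))\<bar> < \<epsilon>"
  using assms
proof (induction m arbitrary: J \<phi> \<A> \<epsilon> E)
  case 0
  then obtain p where "J = {p}" by (auto simp: card_1_singleton_iff)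
  moreover obtain g where "g \<in> E" using Sigma_set_nonempty[OF "0.prems"(8)] by blast
  ultimately show ?case using 0 by (intro bexI[of _ g]) auto
next
  case (Suc m)
  note finJ = \<open>finite J\<close> and add = Suc.prems(3) and ker = Suc.prems(4)
    and fin\<A> = \<open>finite \<A>\<close> and meas = Suc.prems(6) and \<epsilon> = \<open>0 < \<epsilon>\<close>
  obtain p where p: "p \<in> J" using Suc.prems(2) by fastforce
  define J' where "J' = J - {p}"
  define \<psi> where "\<psi> j g = \<phi> j g - \<phi> p g" for j g
  have J': "finite J'" "card J' = Suc m" "J' \<subseteq> J" "p \<notin> J'"
    using finJ Suc.prems(2) p by (auto simp: J'_def)
  have ne: "J' \<noteq> {}" using J' by auto
  have \<psi>_add: "Modules.additive (\<psi> j)" if "j \<in> J'" for j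
    using add[OF p] add[of j] J' that by (auto simp: \<psi>_def Modules.additive_def)
  have \<psi>_ker: "finite {g. \<psi> j g = 0}" if "j \<in> J'" for j
    unfolding \<psi>_def using ker[of p j] p J' that by auto
  have \<psi>_diff: "finite {g. \<psi> j g - \<psi> i g = 0}" if "i \<in> J'" "j \<in> J'" "i \<noteq> j" for i j
    unfolding \<psi>_def using ker[of i j] J' that by auto
  have meas': "A j \<in> sets M" if "A \<in> \<A>" "j \<in> J'" for A j using meas J' that by auto

  \<comment> \<open>With this \<open>\<delta>\<close> the factor \<open>\<epsilon>\<^sup>2 - 3 * \<delta>\<close> in the Bessel-type bound is \<open>\<epsilon>\<^sup>2 / 2\<close>, so each
    tuple rules out at most \<open>2 / \<epsilon>\<^sup>2\<close> indices.\<close>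
  define \<delta> where "\<delta> = \<epsilon>\<^sup>2 / 6"
  have \<delta>: "0 < \<delta>" using \<epsilon> by (simp add: \<delta>_def)
  define c where "c A = (\<Prod>j\<in>J'. prob (A j))" for A
  have c: "0 \<le> c A" "c A \<le> 1" for A
    unfolding c_def by (auto intro!: prod_nonneg prod_le_1)
  obtain g where g: "filterlim g cofinite sequentially"
    and gE: "\<And>K. \<exists>E'. Sigma_set m E' \<and> (\<forall>i\<in>{1..K}. \<forall>h\<in>E'. g i + h \<in> E)"
    using Sigma_set_Suc_split[OF Suc.prems(8)] by blast

  define C where "C A i k j = T (\<psi> j (g i)) ` A j \<inter> T (\<psi> j (g k)) ` A j" for A i k j
  have C_sets: "C A i k j \<in> sets M" if "A \<in> \<A>" "j \<in> J'" for A i k j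
    using meas'[OF that] by (auto simp: C_def)
  have "\<forall>\<^sub>F k in sequentially. \<forall>A\<in>\<A>. \<bar>(\<Prod>j\<in>J'. prob (C A i k j)) - (c A)\<^sup>2\<bar> < \<delta> / 2" for i
  proof (intro eventually_ball_finite[OF fin\<A>] ballI)
    fix A assume "A \<in> \<A>"
    then have "((\<lambda>k. \<Prod>j\<in>J'. prob (C A i k j)) \<longlongrightarrow> (c A)\<^sup>2) sequentially"
      unfolding C_def c_def
      using J' \<psi>_add \<psi>_ker meas' g by (intro product_self_correlation_tendsto) auto
    from tendstoD[OF this, of "\<delta> / 2"] \<delta>
    show "\<forall>\<^sub>F k in sequentially. \<bar>(\<Prod>j\<in>J'. prob (C A i k j)) - (c A)\<^sup>2\<bar> < \<delta> / 2"
      by (simp add: dist_real_def)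
  qed
  then obtain I where I: "finite I" "card I = nat \<lfloor>real (card \<A>) * (2 / \<epsilon>\<^sup>2)\<rfloor> + 1" "\<forall>i\<in>I. 1 \<le> i"
    and I_lt: "\<forall>i\<in>I. \<forall>k\<in>I. i < k \<longrightarrow>
      (\<forall>A\<in>\<A>. \<bar>(\<Prod>j\<in>J'. prob (C A i k j)) - (c A)\<^sup>2\<bar> < \<delta> / 2)"
    using exists_pairwise_eventual_set[of "\<lambda>i k. \<forall>A\<in>\<A>. \<bar>(\<Prod>j\<in>J'. prob (C A i k j)) - (c A)\<^sup>2\<bar> < \<delta> / 2"]
    by meson
  have C_sym: "C A i k = C A k i" for A i k by (auto simp: C_def fun_eq_iff)
  have I_ne: "\<bar>(\<Prod>j\<in>J'. prob (C A i k j)) - (c A)\<^sup>2\<bar> < \<delta> / 2"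
    if "i \<in> I" "k \<in> I" "i \<noteq> k" "A \<in> \<A>" for i k A
  proof (cases "i < k")
    case True
    then show ?thesis using I_lt that by blast
  next
    case False
    then have "\<bar>(\<Prod>j\<in>J'. prob (C A k i j)) - (c A)\<^sup>2\<bar> < \<delta> / 2"
      using I_lt that by (metis linorder_neqE_nat)
    then show ?thesis unfolding C_sym[of A i k] .
  qed
  have card_I: "real (card \<A>) * (2 / \<epsilon>\<^sup>2) < real (card I)"
    unfolding I(2) by linarith

  obtain E' where E': "Sigma_set m E'" and E'E: "\<And>i h. i \<in> {1..Max I} \<Longrightarrow> h \<in> E' \<Longrightarrow> g i + h \<in> E"
    using gE[of "Max I"] by blast
  have "\<exists>h\<in>E'. \<forall>D\<in>(\<lambda>(A, i, k). C A i k) ` (\<A> \<times> I \<times> I).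
      \<bar>prob (\<Inter>j\<in>J'. T (\<psi> j h) ` D j) - (\<Prod>j\<in>J'. prob (D j))\<bar> < \<delta> / 2"
    using J' \<psi>_add \<psi>_diff fin\<A> I(1) C_sets \<delta> E' by (intro Suc.IH) auto
  then obtain h where h: "h \<in> E'"
    and hC: "\<And>A i k. A \<in> \<A> \<Longrightarrow> i \<in> I \<Longrightarrow> k \<in> I \<Longrightarrow>
      \<bar>prob (\<Inter>j\<in>J'. T (\<psi> j h) ` C A i k j) - (\<Prod>j\<in>J'. prob (C A i k j))\<bar> < \<delta> / 2"
    by fastforce

  define B where "B A i = (\<Inter>j\<in>J'. T (\<psi> j (g i + h)) ` A j)" for A i
  have B_sets: "B A i \<in> sets M" if "A \<in> \<A>" for A i
    unfolding B_def using J' ne meas' that by (intro sets.finite_INT) auto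
  have B_Int: "B A i \<inter> B A k = (\<Inter>j\<in>J'. T (\<psi> j h) ` C A i k j)" if A: "A \<in> \<A>" for A i k
  proof -
    have "T (\<psi> j (g i + h)) ` A j \<inter> T (\<psi> j (g k + h)) ` A j = T (\<psi> j h) ` C A i k j"
      if j: "j \<in> J'" for j
      using meas'[OF A j] unfolding C_def
      by (simp add: T_image_Int Modules.additive.add[OF \<psi>_add[OF j]] add.commute[of _ "\<psi> j h"] T_image_add)
    then show ?thesis unfolding B_def INT_Int_distrib[symmetric] by simp
  qed
  \<comment> \<open>The diagonal case \<open>k = i\<close> of the induction hypothesis controls \<open>B A i\<close> itself.\<close>
  have B_single: "\<bar>prob (B A i) - c A\<bar> \<le> \<delta>" if "A \<in> \<A>" "i \<in> I" for A i
  proof -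
    have "(\<Prod>j\<in>J'. prob (C A i i j)) = c A"
      unfolding c_def C_def using meas' that by (intro prod.cong) auto
    then show ?thesis using hC[OF that(1,2,2)] B_Int[OF that(1), of i i] \<delta> by simp
  qed
  have B_pair: "\<bar>prob (B A i \<inter> B A k) - (c A)\<^sup>2\<bar> \<le> \<delta>"
    if "A \<in> \<A>" "i \<in> I" "k \<in> I" "i \<noteq> k" for A i k
    using hC[OF that(1-3)] I_ne[OF that(2-4,1)] unfolding B_Int[OF that(1)] by linarith

  define bad where "bad A = {i \<in> I. \<epsilon> \<le> \<bar>prob (A p \<inter> B A i) - c A * prob (A p)\<bar>}" for A
  have card_bad: "real (card (bad A)) \<le> 2 / \<epsilon>\<^sup>2" if A: "A \<in> \<A>" for A
  proof -
    have "real (card (bad A)) * (\<epsilon>\<^sup>2 - 3 * \<delta>) \<le> 1"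
      unfolding bad_def
      using I(1) meas[OF A p] B_sets[OF A] c \<delta> \<epsilon> B_single[OF A] B_pair[OF A]
      by (intro few_correlated_events) auto
    then show ?thesis using \<epsilon> by (simp add: \<delta>_def field_simps)
  qed
  have "real (card (\<Union>A\<in>\<A>. bad A)) \<le> (\<Sum>A\<in>\<A>. real (card (bad A)))"
    using card_UN_le[OF fin\<A>, of bad] by (simp flip: of_nat_sum)
  also have "\<dots> \<le> real (card \<A>) * (2 / \<epsilon>\<^sup>2)"
    using sum_mono[of \<A> "\<lambda>A. real (card (bad A))" "\<lambda>_. 2 / \<epsilon>\<^sup>2"] card_bad by simp
  also note card_I
  finally have "card (\<Union>A\<in>\<A>. bad A) < card I" by simp
  moreover have "finite (\<Union>A\<in>\<A>. bad A)" using fin\<A> I(1) by (auto simp: bad_def)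
  ultimately have "\<not> I \<subseteq> (\<Union>A\<in>\<A>. bad A)" using card_mono not_le by blast
  then obtain i where i: "i \<in> I" and good: "\<And>A. A \<in> \<A> \<Longrightarrow> i \<notin> bad A" by blast

  have "g i + h \<in> E" using E'E h i I by auto
  moreover have "\<bar>prob (\<Inter>j\<in>J. T (\<phi> j (g i + h)) ` A j) - (\<Prod>j\<in>J. prob (A j))\<bar> < \<epsilon>"
    if A: "A \<in> \<A>" for A
  proof -
    have "prob (\<Inter>j\<in>J. T (\<phi> j (g i + h)) ` A j) = prob (A p \<inter> B A i)"
      unfolding B_def \<psi>_def J'_def
      using finJ p meas[OF A] by (intro prob_INT_T_image_pivot) auto
    moreover have "(\<Prod>j\<in>J. prob (A j)) = c A * prob (A p)"
      unfolding c_def J'_def using prod.remove[OF finJ p, of "\<lambda>j. prob (A j)"] by (simp add: mult.commute)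
    ultimately show ?thesis using good[OF A] i by (auto simp: bad_def)
  qed
  ultimately show ?case by blast
qed

end

theorem theorem1p3:
  fixes M :: "'x::metric_space measure"
    and T :: "'g::{countable, ab_group_add} \<Rightarrow> 'x \<Rightarrow> 'x"
    and l :: nat
    and \<phi> :: "nat \<Rightarrow> 'g \<Rightarrow> 'g"
    and A :: "nat \<Rightarrow> 'x set"
    and \<epsilon> :: real
  assumes "strongly_mixing_system M T"
    and "l \<ge> 1"
    and "\<And>j. j \<in> {1..l} \<Longrightarrow> Modules.additive (\<phi> j)"
    and "\<And>j. j \<in> {1..l} \<Longrightarrow> finite {g. \<phi> j g = 0}"
    and "\<And>i j. i \<in> {1..l} \<Longrightarrow> j \<in> {1..l} \<Longrightarrow> i \<noteq> j \<Longrightarrow> finite {g. \<phi> j g - \<phi> i g = 0}"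
    and "\<And>j. j \<in> {0..l} \<Longrightarrow> A j \<in> sets M"
    and "\<epsilon> > 0"
  shows "Sigma_star l (return_set M T l \<phi> A \<epsilon>)"
proof -
  interpret strongly_mixing_system M T by fact
  define \<phi>' where "\<phi>' j = (if j = 0 then (\<lambda>_. 0) else \<phi> j)" for j
  have add: "Modules.additive (\<phi>' j)" if "j \<in> {0..l}" for j
    using assms(3)[of j] that by (auto simp: \<phi>'_def Modules.additive_def)
  have ker: "finite {g. \<phi>' j g - \<phi>' i g = 0}" if "i \<in> {0..l}" "j \<in> {0..l}" "i \<noteq> j" for i j
    using assms(4)[of i] assms(4)[of j] assms(5)[of i j] that by (auto simp: \<phi>'_def)
  have split: "{0..l} = insert 0 {1..l}" by auto
  have T0: "T 0 ` A 0 = A 0"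
    using sets.sets_into_space[OF assms(6)[of 0]] T_zero by force
  have inter: "(\<Inter>j\<in>{0..l}. T (\<phi>' j g) ` A j) = A 0 \<inter> (\<Inter>j\<in>{1..l}. T (\<phi> j g) ` A j)" for g
    unfolding split by (auto simp: \<phi>'_def T0)
  show ?thesis
    unfolding Sigma_star_def
  proof (intro allI impI)
    fix E :: "'g set" assume E: "Sigma_set l E"
    \<comment> \<open>Putting \<open>\<phi> 0 = 0\<close> turns the kernel conditions on the \<open>\<phi> j\<close> into conditions on differences.\<close>
    have "\<exists>g\<in>E. \<forall>A'\<in>{A}. \<bar>prob (\<Inter>j\<in>{0..l}. T (\<phi>' j g) ` A' j) - (\<Prod>j\<in>{0..l}. prob (A' j))\<bar> < \<epsilon>"
      using add ker assms(6,7) E by (intro Sigma_set_approx_independent) auto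
    then obtain g where "g \<in> E"
      and "\<bar>prob (\<Inter>j\<in>{0..l}. T (\<phi>' j g) ` A j) - (\<Prod>j\<in>{0..l}. prob (A j))\<bar> < \<epsilon>"
      by blast
    then have "g \<in> return_set M T l \<phi> A \<epsilon>"
      unfolding return_set_def inter by simp
    then show "return_set M T l \<phi> A \<epsilon> \<inter> E \<noteq> {}"
      using \<open>g \<in> E\<close> by blast
  qed
qed

end
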